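(* For every positive integer $p$ there is a graph $G_p$ of treewidth $2$ with $\operatorname{pqn}(G_p)\ge p$.
   Context: All graphs are finite, simple and undirected; treewidth is the usual graph parameter. An edge-weighted graph $\langle G,w\rangle$ is a graph $G=(V,E)$ with $w\colon E\to\mathbb{R}$. A PQ-layout of $\langle G,w\rangle$ with $k$ priority queues consists of a linear ordering $\prec$ of $V$ and a partition of $E$ into $k$ sets $\mathcal{P}_1,\dots,\mathcal{P}_k$ such that there is no $i$ and no two edges $e=uv$, $e'=u'v'$ in $\mathcal{P}_i$ with $w(e)>w(e')$ and $u\prec v$, $u'\prec v$, $v\prec v'$. $\operatorname{pqn}(G,w)$ is the minimum $k\ge0$ such that $\langle G,w\rangle$ has a PQ-layout with $k$ priority queues, and $\operatorname{pqn}(G)$ is the minimum $k\ge0$ such that $\operatorname{pqn}(G,w)\le k$ for every $w\colon E\to\mathbb{R}$. *)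

theory Defs
  imports Complex_Main "HOL-Library.Ramsey" "HOL-Library.Disjoint_Sets"
begin

section \<open>Finite simple graphs and treewidth\<close>

definition simple_graph :: "'a set \<Rightarrow> 'a set set \<Rightarrow> bool" where
  "simple_graph V E \<longleftrightarrow> finite V \<and> E \<subseteq> [V]\<^bsup>2\<^esup>"

text \<open>The subgraph induced on \<open>S\<close> is connected (the empty \<open>S\<close> counts as connected).\<close>

definition connected_on :: "'a set set \<Rightarrow> 'a set \<Rightarrow> bool" where
  "connected_on E S \<longleftrightarrow>
     (\<forall>x\<in>S. \<forall>y\<in>S. (x, y) \<in> {(a, b). a \<in> S \<and> b \<in> S \<and> {a, b} \<in> E}\<^sup>*)"

definition is_cycle :: "'a set set \<Rightarrow> 'a list \<Rightarrow> bool" where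
  "is_cycle E xs \<longleftrightarrow> 3 \<le> length xs \<and> distinct xs \<and>
     (\<forall>i<length xs. {xs ! i, xs ! (Suc i mod length xs)} \<in> E)"

definition is_tree :: "'a set \<Rightarrow> 'a set set \<Rightarrow> bool" where
  "is_tree N F \<longleftrightarrow> simple_graph N F \<and> N \<noteq> {} \<and> connected_on F N \<and> (\<nexists>xs. is_cycle F xs)"

definition tree_decomposition ::
  "'a set \<Rightarrow> 'a set set \<Rightarrow> 't set \<Rightarrow> 't set set \<Rightarrow> ('t \<Rightarrow> 'a set) \<Rightarrow> bool" where
  "tree_decomposition V E N F B \<longleftrightarrow>
     is_tree N F \<and>
     (\<Union>t\<in>N. B t) = V \<and>
     (\<forall>e\<in>E. \<exists>t\<in>N. e \<subseteq> B t) \<and>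
     (\<forall>v\<in>V. connected_on F {t \<in> N. v \<in> B t})"

text \<open>Natural-number subtraction only truncates when all bags are empty, that is, for the graph
  without vertices, whose treewidth is therefore 0 here rather than -1.\<close>

definition decomposition_width :: "'t set \<Rightarrow> ('t \<Rightarrow> 'a set) \<Rightarrow> nat" where
  "decomposition_width N B = Max ((\<lambda>t. card (B t)) ` N) - 1"

text \<open>Decomposition trees are finite, so taking their nodes in \<^typ>\<open>nat\<close> loses no generality.\<close>

definition treewidth :: "'a set \<Rightarrow> 'a set set \<Rightarrow> nat" where
  "treewidth V E = (LEAST k. \<exists>(N :: nat set) F B.
     tree_decomposition V E N F B \<and> decomposition_width N B = k)"


section \<open>Priority queue layouts\<close>

text \<open>The strict ordering is the relation \<open>r\<close>, with \<open>(x, y) \<in> r\<close> for \<open>x \<prec> y\<close>. The parts are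
  \<open>P 0, \<dots>, P (k - 1)\<close>, some of which may be empty. The weight \<open>w\<close> is a total function, but only
  its values on \<open>E\<close> are ever used.\<close>

definition PQ_layout ::
  "'a set \<Rightarrow> 'a set set \<Rightarrow> ('a set \<Rightarrow> real) \<Rightarrow> nat \<Rightarrow> 'a rel \<Rightarrow> (nat \<Rightarrow> 'a set set) \<Rightarrow> bool" where
  "PQ_layout V E w k r P \<longleftrightarrow>
     r \<subseteq> V \<times> V \<and> strict_linear_order_on V r \<and>
     (\<Union>i<k. P i) = E \<and> disjoint_family_on P {..<k} \<and>
     \<not> (\<exists>i<k. \<exists>u v u' v'. {u, v} \<in> P i \<and> {u', v'} \<in> P i \<and>
          w {u, v} > w {u', v'} \<and> (u, v) \<in> r \<and> (u', v) \<in> r \<and> (v, v') \<in> r)"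

definition pqn_weighted :: "'a set \<Rightarrow> 'a set set \<Rightarrow> ('a set \<Rightarrow> real) \<Rightarrow> nat" where
  "pqn_weighted V E w = (LEAST k. \<exists>r P. PQ_layout V E w k r P)"

definition pqn :: "'a set \<Rightarrow> 'a set set \<Rightarrow> nat" where
  "pqn V E = (LEAST k. \<forall>w. pqn_weighted V E w \<le> k)"

text \<open>The minima defined above are all attained; for layouts, with one queue per edge every ordering is admissible.\<close>

lemma PQ_layout_card:
  assumes "simple_graph V E"
  shows "\<exists>r P. PQ_layout V E w (card E) r P"
proof -
  have fV: "finite V" using assms by (simp add: simple_graph_def)
  have "E \<subseteq> Pow V" using assms by (auto simp: simple_graph_def nsets_def)
  then have "finite E" using fV by (metis finite_Pow_iff finite_subset)
  then obtain h where h: "bij_betw h {0..<card E} E"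
    using ex_bij_betw_nat_finite by blast
  obtain g :: "'a \<Rightarrow> nat" where g: "inj_on g V"
    using finite_imp_inj_to_nat_seg[OF fV] by blast
  define r where "r = {(x, y). x \<in> V \<and> y \<in> V \<and> g x < g y}"
  have 1: "r \<subseteq> V \<times> V" "strict_linear_order_on V r"
    using g by (auto simp: r_def strict_linear_order_on_def trans_def irrefl_def
        total_on_def dest: inj_onD intro: linorder_neqE_nat)
  have 2: "(\<Union>i<card E. {h i}) = E"
    using bij_betw_imp_surj_on[OF h] by (simp add: lessThan_atLeast0 UNION_singleton_eq_range)
  have 3: "disjoint_family_on (\<lambda>i. {h i}) {..<card E}"
    using h by (auto simp: bij_betw_def disjoint_family_on_def inj_on_def)
  have "PQ_layout V E w (card E) r (\<lambda>i. {h i})"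
    using 1 2 3 by (auto simp: PQ_layout_def)
  then show ?thesis by blast
qed

lemma pqn_weighted_attained:
  assumes "simple_graph V E"
  shows "\<exists>r P. PQ_layout V E w (pqn_weighted V E w) r P"
  unfolding pqn_weighted_def by (rule LeastI) (rule PQ_layout_card[OF assms])

lemma pqn_weighted_le_pqn:
  assumes "simple_graph V E"
  shows "pqn_weighted V E w \<le> pqn V E"
proof -
  have "\<forall>w. pqn_weighted V E w \<le> card E"
    unfolding pqn_weighted_def by (blast intro: Least_le PQ_layout_card[OF assms])
  then have "\<forall>w. pqn_weighted V E w \<le> pqn V E"
    unfolding pqn_def by (rule LeastI)
  then show ?thesis by blast
qed

lemma treewidth_attained:
  assumes "simple_graph V E"
  shows "\<exists>(N :: nat set) F B.
    tree_decomposition V E N F B \<and> decomposition_width N B = treewidth V E"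
proof -
  have "\<not> is_cycle {} xs" for xs :: "nat list"
  proof
    assume c: "is_cycle {} xs"
    then have "0 < length xs" unfolding is_cycle_def by linarith
    with c show False unfolding is_cycle_def by blast
  qed
  then have "is_tree {0 :: nat} {}"
    by (simp add: is_tree_def simple_graph_def connected_on_def)
  then have "tree_decomposition V E {0 :: nat} {} (\<lambda>_. V)"
    using assms by (auto simp: tree_decomposition_def simple_graph_def connected_on_def nsets_def)
  then have "\<exists>k. \<exists>(N :: nat set) F B.
      tree_decomposition V E N F B \<and> decomposition_width N B = k"
    by blast
  then show ?thesis
    unfolding treewidth_def by (rule LeastI_ex)
qed

end

theory Submission imports Defs "HOL-Library.Transitive_Closure_Table" begin

text \<open>The graphs are complete trees of large depth and branching in which every node is also joined to
  its grandparent. Suppose that fewer than \<open>p\<close> queues suffice. By pigeonhole many edges with a common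
  end share a queue, and suitable weights then force almost all children of a node to precede it.
  Walk down the tree: of two siblings whose edges to their left children use the same queues, let \<open>m\<close>
  be the earlier and \<open>y\<close> the later one. The weights force all left children of \<open>y\<close> of one kind to come
  after \<open>m\<close>. Continue from \<open>y\<close> through these children. The edge from \<open>m\<close> to its parent is then still
  in its queue whenever a later node of the walk removes its edges. Deeper edges are heavier, so each
  level of the walk needs a new queue, and after \<open>p + 1\<close> levels there are none left.\<close>

section \<open>Treewidth\<close>

text \<open>A path without repeated nodes from \<open>s\<close> to \<open>t\<close> that avoids the
  edge \<open>{s, t}\<close> has at least two steps, so this edge closes it to a cycle.\<close>

lemma bridge_in_acyclic_graph:
  assumes "\<nexists>xs. is_cycle F xs" "{s, t} \<in> F" "s \<noteq> t"
  shows "(s, t) \<notin> {(a, b). {a, b} \<in> F - {{s, t}}}\<^sup>*"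
proof
  let ?R = "\<lambda>a b. {a, b} \<in> F - {{s, t}}"
  assume "(s, t) \<in> {(a, b). {a, b} \<in> F - {{s, t}}}\<^sup>*"
  then have "?R\<^sup>*\<^sup>* s t" by (simp add: rtranclp_rtrancl_eq)
  then obtain xs0 where "rtrancl_path ?R s xs0 t" by (auto simp: rtranclp_eq_rtrancl_path)
  then obtain xs where xs: "rtrancl_path ?R s xs t" "distinct (s # xs)"
    by (rule rtrancl_path_distinct)
  have ne: "xs \<noteq> []" using xs(1) \<open>s \<noteq> t\<close> by (auto elim: rtrancl_path.cases)
  have last: "last xs = t" using rtrancl_path_last[OF xs(1) ne] .
  have step: "{(s # xs) ! i, xs ! i} \<in> F - {{s, t}}" if "i < length xs" for i
    using rtrancl_path_nth[OF xs(1) that] .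
  have len: "2 \<le> length xs"
  proof (rule ccontr)
    assume "\<not> 2 \<le> length xs"
    with ne have "length xs = 1" by (cases xs) (auto simp: Suc_le_eq)
    then have "xs ! 0 = t" using last ne by (simp add: last_conv_nth)
    with step[of 0] ne show False by simp
  qed
  have "is_cycle F (s # xs)"
    unfolding is_cycle_def
  proof (intro conjI allI impI)
    show "3 \<le> length (s # xs)" using len by simp
    show "distinct (s # xs)" by (fact xs(2))
    fix i assume i: "i < length (s # xs)"
    show "{(s # xs) ! i, (s # xs) ! (Suc i mod length (s # xs))} \<in> F"
    proof (cases "i < length xs")
      case True
      then show ?thesis using step[of i] by simp
    next
      case False
      then have i: "i = length xs" using i by simp
      then have "(s # xs) ! i = t" using last ne by (simp add: last_conv_nth nth_Cons')
      then show ?thesis using i assms(2) by (simp add: insert_commute)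
    qed
  qed
  with assms(1) show False by blast
qed

text \<open>Backward induction from \<open>b\<close>: a step prepended to a walk outside
  \<open>S\<close> either stays outside or is itself the last exit.\<close>

lemma rtrancl_last_exit:
  assumes "(a, b) \<in> r\<^sup>*" "a \<in> S" "b \<notin> S"
  shows "(\<exists>c\<in>S. \<exists>d. d \<notin> S \<and> (c, d) \<in> r \<and> (d, b) \<in> (r \<inter> (- S) \<times> (- S))\<^sup>*)" (is ?exit)
proof -
  have "a \<notin> S \<and> (a, b) \<in> (r \<inter> (- S) \<times> (- S))\<^sup>* \<or> ?exit"
    using assms(1)
  proof (induction rule: converse_rtrancl_induct)
    case base
    then show ?case using assms(3) by simp
  next
    case (step y z)
    show ?case
    proof (cases ?exit)
      case False
      then have z: "z \<notin> S" "(z, b) \<in> (r \<inter> (- S) \<times> (- S))\<^sup>*" using step.IH by satx+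
      then have "y \<notin> S" using False step.hyps(1) by metis
      then have "(y, z) \<in> r \<inter> (- S) \<times> (- S)" using step.hyps(1) z(1) by simp
      then show ?thesis using z(2) \<open>y \<notin> S\<close> by (meson converse_rtrancl_into_rtrancl)
    qed simp
  qed
  then show ?exit using assms(2) by satx
qed

text \<open>If no bag contains the triangle, follow the \<open>x\<close>-subtree from the bag of \<open>xy\<close> to that of
  \<open>xz\<close> and let \<open>s, s'\<close> be the last edge leaving the \<open>y\<close>-subtree. The \<open>y\<close>-subtree avoids \<open>s'\<close> and the
  \<open>z\<close>-subtree avoids \<open>s\<close>, so going around through the bag of \<open>yz\<close> joins \<open>s\<close> to \<open>s'\<close> without this edge.\<close>

lemma triangle_in_bag:
  assumes td: "tree_decomposition V E N F B"
    and E: "{x, y} \<in> E" "{y, z} \<in> E" "{x, z} \<in> E"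
  shows "\<exists>t\<in>N. {x, y, z} \<subseteq> B t"
proof (rule ccontr)
  assume none: "\<not> ?thesis"
  have tree: "is_tree N F" and bags: "(\<Union>t\<in>N. B t) = V"
    and conn: "\<And>v. v \<in> V \<Longrightarrow> connected_on F {t \<in> N. v \<in> B t}"
    and cover: "\<And>e. e \<in> E \<Longrightarrow> \<exists>t\<in>N. e \<subseteq> B t"
    using td by (auto simp: tree_decomposition_def)
  obtain txy tyz txz where t: "txy \<in> N" "{x, y} \<subseteq> B txy" "tyz \<in> N" "{y, z} \<subseteq> B tyz"
    "txz \<in> N" "{x, z} \<subseteq> B txz"
    using cover[OF E(1)] cover[OF E(2)] cover[OF E(3)] by blast
  define R where "R v = {(a, b). a \<in> {t \<in> N. v \<in> B t} \<and> b \<in> {t \<in> N. v \<in> B t} \<and> {a, b} \<in> F}" for v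
  have R: "(a, b) \<in> (R v)\<^sup>*" if "a \<in> N" "b \<in> N" "v \<in> B a" "v \<in> B b" for a b v
    using conn[of v] that bags by (auto simp: connected_on_def R_def)
  define S where "S = {t \<in> N. y \<in> B t}"
  have "(txy, txz) \<in> (R x)\<^sup>*" "txy \<in> S" "txz \<notin> S"
    using R t none by (auto simp: S_def)
  then obtain s s' where s: "s \<in> S" "s' \<notin> S" "(s, s') \<in> R x"
    "(s', txz) \<in> (R x \<inter> (- S) \<times> (- S))\<^sup>*"
    using rtrancl_last_exit by metis
  let ?F = "{(a, b). {a, b} \<in> F - {{s, s'}}}"
  have "s \<notin> {t \<in> N. z \<in> B t}" "s \<in> N" "y \<in> B s" using s none by (auto simp: R_def S_def)
  have "(s, tyz) \<in> (R y)\<^sup>*" using R s t by (auto simp: S_def)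
  moreover have "R y \<subseteq> ?F" using s by (auto simp: R_def S_def doubleton_eq_iff)
  ultimately have 1: "(s, tyz) \<in> ?F\<^sup>*" using rtrancl_mono by blast
  have "(tyz, txz) \<in> (R z)\<^sup>*" using R t by auto
  moreover have "R z \<subseteq> ?F" using \<open>s \<notin> _\<close> by (auto simp: R_def doubleton_eq_iff)
  ultimately have 2: "(tyz, txz) \<in> ?F\<^sup>*" using rtrancl_mono by blast
  have "R x \<inter> (- S) \<times> (- S) \<subseteq> ?F" using s by (auto simp: R_def doubleton_eq_iff)
  then have "(s', txz) \<in> ?F\<^sup>*" using s(4) rtrancl_mono by blast
  moreover have "sym ?F" by (auto simp: sym_def insert_commute)
  ultimately have 3: "(txz, s') \<in> ?F\<^sup>*" by (meson sym_rtrancl symD)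
  have "(s, s') \<in> ?F\<^sup>*" using 1 2 3 by (meson rtrancl_trans)
  moreover have "{s, s'} \<in> F" "s \<noteq> s'" using s by (auto simp: R_def)
  moreover have "\<nexists>xs. is_cycle F xs" using tree by (simp add: is_tree_def)
  ultimately show False using bridge_in_acyclic_graph[of F s s'] by simp
qed

lemma treewidth_ge_2_triangle:
  assumes "simple_graph V E" "{x, y} \<in> E" "{y, z} \<in> E" "{x, z} \<in> E"
    and "x \<noteq> y" "y \<noteq> z" "x \<noteq> z"
  shows "2 \<le> treewidth V E"
proof -
  obtain N :: "nat set" and F B where td: "tree_decomposition V E N F B"
    and w: "decomposition_width N B = treewidth V E"
    using treewidth_attained[OF assms(1)] by blast
  obtain t where t: "t \<in> N" "{x, y, z} \<subseteq> B t" using triangle_in_bag[OF td assms(2-4)] by blast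
  have fin: "finite N" using td by (simp add: tree_decomposition_def is_tree_def simple_graph_def)
  have "finite V" using assms(1) by (simp add: simple_graph_def)
  moreover have "B t \<subseteq> V" using td t by (auto simp: tree_decomposition_def)
  ultimately have "finite (B t)" by (rule finite_subset[rotated])
  then have "card {x, y, z} \<le> card (B t)" using t(2) by (rule card_mono)
  moreover have "card {x, y, z} = 3" using assms by simp
  moreover have "card (B t) \<le> Max ((\<lambda>t. card (B t)) ` N)" using fin t by simp
  ultimately show ?thesis using w by (simp add: decomposition_width_def)
qed

lemma connected_onI_root:
  assumes "\<And>x. x \<in> S \<Longrightarrow> (x, v) \<in> {(a, b). a \<in> S \<and> b \<in> S \<and> {a, b} \<in> F}\<^sup>*"
  shows "connected_on F S"
proof -
  let ?R = "{(a, b). a \<in> S \<and> b \<in> S \<and> {a, b} \<in> F}"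
  have "sym (?R\<^sup>*)" by (intro sym_rtrancl) (auto simp: sym_def insert_commute)
  then have "(v, x) \<in> ?R\<^sup>*" if "x \<in> S" for x using assms[OF that] by (rule symD)
  then have "(x, y) \<in> ?R\<^sup>*" if "x \<in> S" "y \<in> S" for x y
    using rtrancl_trans[OF assms[OF that(1)]] that(2) by simp
  then show ?thesis unfolding connected_on_def by simp
qed

section \<open>Rooted trees with grandparent edges\<close>

definition tree_edges :: "(nat \<Rightarrow> nat) \<Rightarrow> nat \<Rightarrow> nat set set" where
  "tree_edges f n = {{y, f y} | y. 0 < y \<and> y < n}"

text \<open>For a parent function whose root \<open>0\<close> is its own parent,
  \<open>0 < f y\<close> leaves out the root and its children.\<close>

definition grandparent_edges :: "(nat \<Rightarrow> nat) \<Rightarrow> nat \<Rightarrow> nat set set" where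
  "grandparent_edges f n = {{y, f (f y)} | y. 0 < f y \<and> y < n}"

locale rooted_tree =
  fixes f :: "nat \<Rightarrow> nat" and n :: nat
  assumes f_0: "f 0 = 0" and f_less: "0 < y \<Longrightarrow> f y < y"
begin

lemma f_le: "f y \<le> y"
  using f_0 f_less[of y] by (cases "y = 0") auto

lemma f_pos: "0 < f y \<Longrightarrow> 0 < y"
  using f_0 by (cases "y = 0") auto

lemma tree_edges_nsets: "tree_edges f n \<subseteq> [{..<n}]\<^bsup>2\<^esup>"
proof
  fix e assume "e \<in> tree_edges f n"
  then obtain y where "e = {y, f y}" "0 < y" "y < n" by (auto simp: tree_edges_def)
  then show "e \<in> [{..<n}]\<^bsup>2\<^esup>" using f_less[of y] by (auto simp: nsets_def)
qed

lemma grandparent_edges_nsets: "grandparent_edges f n \<subseteq> [{..<n}]\<^bsup>2\<^esup>"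
proof
  fix e assume "e \<in> grandparent_edges f n"
  then obtain y where "e = {y, f (f y)}" "0 < f y" "y < n" by (auto simp: grandparent_edges_def)
  then show "e \<in> [{..<n}]\<^bsup>2\<^esup>" using f_less[of "f y"] f_le[of y] by (auto simp: nsets_def)
qed

lemma simple_graph_grandparent: "simple_graph {..<n} (tree_edges f n \<union> grandparent_edges f n)"
  using tree_edges_nsets grandparent_edges_nsets by (simp add: simple_graph_def)

lemma tree_edge_less: "{x, y} \<in> tree_edges f n \<Longrightarrow> x \<le> y \<Longrightarrow> x = f y"
proof -
  assume "{x, y} \<in> tree_edges f n" "x \<le> y"
  then obtain z where "{x, y} = {z, f z}" "0 < z" by (auto simp: tree_edges_def)
  moreover have "f z < z" using f_less[OF \<open>0 < z\<close>] .
  ultimately show "x = f y" using \<open>x \<le> y\<close> by (auto simp: doubleton_eq_iff)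
qed

text \<open>The largest node of a cycle would have two smaller neighbours, but only its parent is smaller.\<close>

lemma no_cycle: "\<nexists>xs. is_cycle (tree_edges f n) xs"
proof
  assume "\<exists>xs. is_cycle (tree_edges f n) xs"
  then obtain xs where c: "is_cycle (tree_edges f n) xs" ..
  let ?l = "length xs"
  have l: "3 \<le> ?l" and d: "distinct xs"
    and e: "\<And>i. i < ?l \<Longrightarrow> {xs ! i, xs ! (Suc i mod ?l)} \<in> tree_edges f n"
    using c by (auto simp: is_cycle_def)
  have ne: "xs \<noteq> []" using l by auto
  obtain i where i: "i < ?l" "xs ! i = Max (set xs)"
    using Max_in[of "set xs"] ne by (metis List.finite_set in_set_conv_nth set_empty)
  \<comment> \<open>The cyclic predecessor of \<open>i\<close>; it cannot equal the successor on a
    cycle of at least three nodes.\<close>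
  define j where "j = (if i = 0 then ?l - 1 else i - 1)"
  have j: "j < ?l" "Suc j mod ?l = i" using i l by (auto simp: j_def)
  have max: "xs ! k \<le> xs ! i" if "k < ?l" for k using i that by simp
  have k: "Suc i mod ?l < ?l" using l by (intro mod_less_divisor) linarith
  have "xs ! (Suc i mod ?l) = f (xs ! i)"
    using tree_edge_less e[OF i(1)] max[OF k] by (metis insert_commute)
  moreover have "xs ! j = f (xs ! i)"
    using tree_edge_less e[OF j(1)] max[OF j(1)] j(2) by metis
  ultimately have "Suc i mod ?l = j" using nth_eq_iff_index_eq[OF d k j(1)] by simp
  then show False using i l by (cases "Suc i = ?l") (auto simp: j_def split: if_splits)
qed

lemma tree_edgesI: "0 < y \<Longrightarrow> y < n \<Longrightarrow> {y, f y} \<in> tree_edges f n"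
  by (auto simp: tree_edges_def)

lemma is_tree_tree_edges:
  assumes "0 < n"
  shows "is_tree {..<n} (tree_edges f n)"
proof -
  have "(x, 0) \<in> {(a, b). a \<in> {..<n} \<and> b \<in> {..<n} \<and> {a, b} \<in> tree_edges f n}\<^sup>*"
    if "x \<in> {..<n}" for x
    using that
  proof (induction x rule: less_induct)
    case (less x)
    show ?case
    proof (cases "x = 0")
      case False
      then have "f x < x" "{x, f x} \<in> tree_edges f n" using f_less tree_edgesI less.prems by auto
      moreover have "f x \<in> {..<n}" using \<open>f x < x\<close> less.prems by simp
      ultimately show ?thesis
        using less.prems by (intro converse_rtrancl_into_rtrancl[OF _ less.IH[of "f x"]]) simp_all
    qed simp
  qed
  then have "connected_on (tree_edges f n) {..<n}" by (rule connected_onI_root)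
  then show ?thesis
    using assms tree_edges_nsets no_cycle by (auto simp: is_tree_def simple_graph_def)
qed

text \<open>The bags containing \<open>v\<close> are those of \<open>v\<close>, its children and its
  grandchildren, and each of these reaches \<open>v\<close> by passing to parents. Every edge lies
  in the bag of its lower end.\<close>

lemma tree_decomposition_grandparent:
  assumes "0 < n"
  shows "tree_decomposition {..<n} (tree_edges f n \<union> grandparent_edges f n)
    {..<n} (tree_edges f n) (\<lambda>t. {t, f t, f (f t)})"
proof -
  have "connected_on (tree_edges f n) {t \<in> {..<n}. v \<in> {t, f t, f (f t)}}" (is "connected_on _ ?S") 
    if "v < n" for v
  proof (rule connected_onI_root)
    fix x assume x: "x \<in> ?S"
    define R where "R = {(a, b). a \<in> ?S \<and> b \<in> ?S \<and> {a, b} \<in> tree_edges f n}"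
    have step: "(y, f y) \<in> R \<and> f y \<in> ?S" if "y \<in> ?S" "y \<noteq> v" for y
    proof -
      have "0 < y" using that f_0 by (cases "y = 0") auto
      moreover have "f y < n" using that f_le[of y] by auto
      ultimately show ?thesis using that tree_edgesI[of y] by (auto simp: R_def)
    qed
    have "(x, v) \<in> R\<^sup>*"
    proof (cases "x = v \<or> f x = v")
      case True
      then show ?thesis using step[OF x] by (cases "x = v") auto
    next
      case False
      then have "(x, f x) \<in> R" "(f x, f (f x)) \<in> R" using step[OF x] step[of "f x"] by blast+
      moreover have "f (f x) = v" using x False by simp
      ultimately show ?thesis by (metis r_into_rtrancl rtrancl.rtrancl_into_rtrancl)
    qed
    then show "(x, v) \<in> {(a, b). a \<in> ?S \<and> b \<in> ?S \<and> {a, b} \<in> tree_edges f n}\<^sup>*"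
      unfolding R_def .
  qed
  moreover have "f t < n" if "t < n" for t using f_le[of t] that by simp
  then have "(\<Union>t\<in>{..<n}. {t, f t, f (f t)}) = {..<n}" by auto
  moreover have "\<exists>t\<in>{..<n}. e \<subseteq> {t, f t, f (f t)}"
    if "e \<in> tree_edges f n \<union> grandparent_edges f n" for e
    using that by (auto simp: tree_edges_def grandparent_edges_def)
  ultimately show ?thesis using is_tree_tree_edges[OF assms] unfolding tree_decomposition_def by auto
qed

text \<open>Bags of at most three nodes give the upper bound, the triangle \<open>y\<close>,
  \<open>f y\<close>, \<open>f (f y)\<close> the lower one.\<close>

lemma treewidth_grandparent:
  assumes "0 < f y" "y < n"
  shows "treewidth {..<n} (tree_edges f n \<union> grandparent_edges f n) = 2"
proof (rule antisym)
  let ?E = "tree_edges f n \<union> grandparent_edges f n"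
  let ?B = "\<lambda>t. {t, f t, f (f t)}"
  have "tree_decomposition {..<n} ?E {..<n} (tree_edges f n) ?B"
    using tree_decomposition_grandparent assms by simp
  then have "treewidth {..<n} ?E \<le> decomposition_width {..<n} ?B"
    unfolding treewidth_def by (intro Least_le) blast
  also have "Max ((\<lambda>t. card (?B t)) ` {..<n}) \<le> 3"
    using assms by (intro Max.boundedI) (auto simp: card_insert_if)
  then have "decomposition_width {..<n} ?B \<le> 2" by (simp add: decomposition_width_def)
  finally show "treewidth {..<n} ?E \<le> 2" .
  have "f (f y) < f y" "f y < y" using f_less f_pos assms by auto
  then show "2 \<le> treewidth {..<n} ?E"
    using assms
    by (intro treewidth_ge_2_triangle[OF simple_graph_grandparent, of y "f y" "f (f y)"])
      (auto simp: tree_edges_def grandparent_edges_def)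
qed

end

section \<open>The weighted graph\<close>

definition parent :: "nat \<Rightarrow> nat \<Rightarrow> nat" where
  "parent M y = (y - 1) div M"

definition slot :: "nat \<Rightarrow> nat \<Rightarrow> nat" where
  "slot M y = (y - 1) mod M"

text \<open>Nodes are numbered as in a heap of branching \<open>2 * N\<close>, with root \<open>0\<close> its own parent. The Boolean
  separates the first \<open>N\<close> children of a node from the last \<open>N\<close>.\<close>

definition children :: "nat \<Rightarrow> nat \<Rightarrow> bool \<Rightarrow> nat set" where
  "children N x b = (if b then {2 * N * x + 1..2 * N * x + N} else {2 * N * x + N + 1..2 * N * x + 2 * N})"

text \<open>Three digits to base \<open>M\<close>: deeper edges along a branch are heavier, the last digit increases with
  \<open>y\<close>, and the middle digit makes edges below siblings increase with the sibling for the first kind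
  of children and decrease for the second kind.\<close>

definition tree_weight :: "nat \<Rightarrow> nat \<Rightarrow> nat" where
  "tree_weight N y = (let M = 2 * N; c = parent M y in
     parent M c * M\<^sup>2 + (if slot M y < N then slot M c else M - 1 - slot M c) * M + slot M y)"

text \<open>Among siblings of one kind with increasing numbers, edges to the parent get heavier and
  edges to the grandparent lighter. Within a queue the two sorts of edges thus force opposite orders
  on siblings to the right.\<close>

definition edge_weight :: "nat \<Rightarrow> nat set \<Rightarrow> real" where
  "edge_weight N e = (if Min e = parent (2 * N) (Max e)
     then real (tree_weight N (Max e)) else - real (Max e))"

lemma rooted_tree_parent: "rooted_tree (parent M)"
proof
  fix y :: nat assume "0 < y"
  then show "parent M y < y" unfolding parent_def
    by (metis One_nat_def diff_Suc_less div_le_dividend le_less_trans)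
qed (simp add: parent_def)

lemma finite_children [simp]: "finite (children N x b)"
  by (simp add: children_def)

lemma card_children [simp]: "card (children N x b) = N"
  by (simp add: children_def)

lemma children_bounds:
  assumes "y \<in> children N x b"
  shows "x < y" "y \<le> 2 * N * x + 2 * N"
proof -
  have "0 < N" using assms by (cases "N = 0") (auto simp: children_def split: if_splits)
  then have "x \<le> 2 * N * x" by simp
  moreover have "2 * N * x < y" "y \<le> 2 * N * x + 2 * N"
    using assms by (auto simp: children_def split: if_splits)
  ultimately show "x < y" "y \<le> 2 * N * x + 2 * N" by linarith+
qed

lemma children_slot:
  assumes "y \<in> children N x b"
  shows "parent (2 * N) y = x" "slot (2 * N) y < N \<longleftrightarrow> b" "slot (2 * N) y < 2 * N"
    "y = 2 * N * x + slot (2 * N) y + 1"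
proof -
  obtain j where j: "y = 2 * N * x + j + 1" "j < N \<longleftrightarrow> b" "j < 2 * N"
  proof
    show "y = 2 * N * x + (y - 2 * N * x - 1) + 1"
      using assms by (auto simp: children_def split: if_splits)
  qed (use assms in \<open>auto simp: children_def split: if_splits\<close>)
  then have "y - 1 = 2 * N * x + j" by simp
  then have "parent (2 * N) y = x" "slot (2 * N) y = j"
    using j by (simp_all add: parent_def slot_def)
  with j show "parent (2 * N) y = x" "slot (2 * N) y < N \<longleftrightarrow> b" "slot (2 * N) y < 2 * N"
    "y = 2 * N * x + slot (2 * N) y + 1" by auto
qed

section \<open>Comparison of weights\<close>

text \<open>The two lower digits together stay below \<open>(2 * N)\<^sup>2\<close>, so the leading
  digit, the grandparent of \<open>y\<close>, dominates.\<close>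

lemma tree_weight_bounds:
  assumes "0 < N"
  shows "parent (2 * N) (parent (2 * N) y) * (2 * N)\<^sup>2 \<le> tree_weight N y"
    and "tree_weight N y < (parent (2 * N) (parent (2 * N) y) + 1) * (2 * N)\<^sup>2"
proof -
  let ?M = "2 * N"
  define k where "k = (if slot ?M y < N then slot ?M (parent ?M y) else ?M - 1 - slot ?M (parent ?M y))"
  have s: "slot ?M z < ?M" for z using assms by (simp add: slot_def)
  have "k + 1 \<le> ?M" using s[of "parent ?M y"] assms by (auto simp: k_def)
  then have "(k + 1) * ?M \<le> ?M * ?M" by (rule mult_le_mono1)
  then have "k * ?M + slot ?M y < ?M\<^sup>2" using s[of y] by (simp add: power2_eq_square)
  moreover have "tree_weight N y = parent ?M (parent ?M y) * ?M\<^sup>2 + k * ?M + slot ?M y"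
    by (simp add: tree_weight_def k_def Let_def)
  ultimately show "parent ?M (parent ?M y) * ?M\<^sup>2 \<le> tree_weight N y"
    "tree_weight N y < (parent ?M (parent ?M y) + 1) * ?M\<^sup>2"
    by simp_all
qed

text \<open>Siblings of one kind agree in the two upper digits.\<close>

lemma tree_weight_siblings:
  assumes "y \<in> children N x b" "y' \<in> children N x b" "y < y'"
  shows "tree_weight N y < tree_weight N y'"
  using assms children_slot[OF assms(1)] children_slot[OF assms(2)]
  by (simp add: tree_weight_def Let_def)

lemma less_mult_add:
  assumes "k < k'" "j < (M :: nat)"
  shows "k * M + j < k' * M + j'"
proof -
  have "(k + 1) * M \<le> k' * M" using assms(1) by (intro mult_le_mono1) simp
  then show ?thesis using assms(2) by simp
qed

text \<open>The leading digit is \<open>x\<close> for both edges, so the middle digit decides: the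
  slot of the parent or its reversal.\<close>

lemma tree_weight_cousins:
  assumes c: "c \<in> children N x s" "c' \<in> children N x s" "c < c'"
    and d: "d \<in> children N c b" "d' \<in> children N c' b"
  shows "if b then tree_weight N d < tree_weight N d' else tree_weight N d' < tree_weight N d"
proof -
  note s = children_slot[OF c(1)] children_slot[OF c(2)] children_slot[OF d(1)] children_slot[OF d(2)]
  let ?M = "2 * N"
  have lt: "slot ?M c < slot ?M c'" using s c(3) by linarith
  then have "?M - 1 - slot ?M c' < ?M - 1 - slot ?M c" using s by linarith
  with lt less_mult_add[of "slot ?M c" "slot ?M c'" "slot ?M d" ?M "slot ?M d'"]
    less_mult_add[of "?M - 1 - slot ?M c'" "?M - 1 - slot ?M c" "slot ?M d'" ?M "slot ?M d"]
  show ?thesis using s by (auto simp: tree_weight_def Let_def)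
qed

lemma edge_weight_tree:
  assumes "0 < y"
  shows "edge_weight N {y, parent (2 * N) y} = tree_weight N y"
    and "edge_weight N {parent (2 * N) y, y} = tree_weight N y"
proof -
  have "parent (2 * N) y < y" using rooted_tree.f_less[OF rooted_tree_parent assms] .
  then show "edge_weight N {y, parent (2 * N) y} = tree_weight N y"
    by (simp add: edge_weight_def max_def min_def)
  then show "edge_weight N {parent (2 * N) y, y} = tree_weight N y"
    by (simp add: insert_commute)
qed

lemma edge_weight_grandparent:
  assumes "0 < parent (2 * N) y"
  shows "edge_weight N {y, parent (2 * N) (parent (2 * N) y)} = - real y"
proof -
  interpret rooted_tree "parent (2 * N)" by (rule rooted_tree_parent)
  have "parent (2 * N) (parent (2 * N) y) < parent (2 * N) y" "parent (2 * N) y < y"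
    using f_less f_pos assms by auto
  then show ?thesis by (simp add: edge_weight_def max_def min_def)
qed

section \<open>Layouts with few queues\<close>

lemma pigeonhole_less:
  fixes A :: "'a :: linorder set"
  assumes "f ` A \<subseteq> B" "finite B" "card B < card A"
  shows "\<exists>x\<in>A. \<exists>y\<in>A. x < y \<and> f x = f y"
proof -
  have "card (f ` A) < card A" using card_mono[OF assms(2,1)] assms(3) by simp
  then have "\<not> inj_on f A" by (rule pigeonhole)
  then show ?thesis unfolding inj_on_def by (metis linorder_neqE)
qed

lemma pigeonhole_fibre:
  assumes "finite A" "f ` A \<subseteq> {..<p :: nat}" "p * m < card A"
  shows "\<exists>q<p. m < card {x \<in> A. f x = q}"
proof (rule ccontr)
  assume "\<not> ?thesis"
  then have le: "card {x \<in> A. f x = q} \<le> m" if "q < p" for q using that by (meson not_le)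
  have "A = (\<Union>q<p. {x \<in> A. f x = q})" using assms(2) by auto
  then have "card A \<le> (\<Sum>q<p. card {x \<in> A. f x = q})"
    using card_UN_le[of "{..<p}" "\<lambda>q. {x \<in> A. f x = q}"] by simp
  also have "\<dots> \<le> (\<Sum>q<p. m)" using le by (intro sum_mono) simp
  finally show False using assms(3) by simp
qed

definition grandparent_graph :: "nat \<Rightarrow> nat \<Rightarrow> nat set set" where
  "grandparent_graph N n = tree_edges (parent (2 * N)) n \<union> grandparent_edges (parent (2 * N)) n"

text \<open>\<open>Q e\<close> is the queue of \<open>e\<close>. The value of \<open>N\<close>
  leaves \<open>p ^ 3 + 1\<close> children of each kind when \<open>2 * p ^ 3\<close> are
  discarded.\<close>

locale few_queues =
  fixes p N n :: nat and r :: "nat rel" and Q :: "nat set \<Rightarrow> nat"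
  assumes N: "N = 3 * p ^ 3 + 1"
    and order: "strict_linear_order_on {..<n} r"
    and Q_less: "e \<in> grandparent_graph N n \<Longrightarrow> Q e < p"
    and no_conflict: "\<lbrakk>{u, v} \<in> grandparent_graph N n; {u', v'} \<in> grandparent_graph N n;
      Q {u, v} = Q {u', v'}; edge_weight N {u', v'} < edge_weight N {u, v};
      (u, v) \<in> r; (u', v) \<in> r; (v, v') \<in> r\<rbrakk> \<Longrightarrow> False"
begin

abbreviation before (infix "\<sqsubset>" 50) where "x \<sqsubset> y \<equiv> (x, y) \<in> r"

text \<open>\<open>last_grandchild x < n\<close> ensures that cutting the tree off at
  \<open>n\<close> removes no child or grandchild of \<open>x\<close>.\<close>

definition last_grandchild :: "nat \<Rightarrow> nat" where
  "last_grandchild x = 2 * N * (2 * N * x + 2 * N) + 2 * N"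

lemma before_trans: "x \<sqsubset> y \<Longrightarrow> y \<sqsubset> z \<Longrightarrow> x \<sqsubset> z"
  using order unfolding strict_linear_order_on_def trans_def by blast

lemma before_total: "x < n \<Longrightarrow> y < n \<Longrightarrow> x \<noteq> y \<Longrightarrow> \<not> x \<sqsubset> y \<Longrightarrow> y \<sqsubset> x"
  using order unfolding strict_linear_order_on_def total_on_def by blast

lemma N_pos: "0 < N"
  using N by simp

lemma child_edge:
  assumes "y \<in> children N x b" "y < n"
  shows "{y, x} \<in> grandparent_graph N n" "{x, y} \<in> grandparent_graph N n"
    "edge_weight N {y, x} = tree_weight N y" "edge_weight N {x, y} = tree_weight N y"
proof -
  have y: "parent (2 * N) y = x" "0 < y"
    using children_slot[OF assms(1)] children_bounds[OF assms(1)] by auto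
  then show "{y, x} \<in> grandparent_graph N n"
    using assms(2) by (auto simp: grandparent_graph_def tree_edges_def)
  then show "{x, y} \<in> grandparent_graph N n" by (simp add: insert_commute)
  show "edge_weight N {y, x} = tree_weight N y" "edge_weight N {x, y} = tree_weight N y"
    using edge_weight_tree[OF y(2), of N] y(1) by simp_all
qed

lemma grandchild_edge:
  assumes "d \<in> children N c b" "c \<in> children N a s" "d < n"
  shows "{a, d} \<in> grandparent_graph N n" "edge_weight N {a, d} = - real d"
proof -
  have "parent (2 * N) d = c" "parent (2 * N) c = a" "0 < c"
    using children_slot[OF assms(1)] children_slot[OF assms(2)] children_bounds[OF assms(2)] by auto
  then have *: "{d, a} \<in> grandparent_graph N n" "edge_weight N {d, a} = - real d"
    using assms(3) edge_weight_grandparent[of N d]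
    by (auto simp: grandparent_graph_def grandparent_edges_def)
  then show "{a, d} \<in> grandparent_graph N n" "edge_weight N {a, d} = - real d"
    by (simp_all add: insert_commute)
qed

lemma grandchild_less:
  assumes "d \<in> children N c b" "c \<in> children N a s" "last_grandchild a < n"
  shows "d < n"
proof -
  have "2 * N * c \<le> 2 * N * (2 * N * a + 2 * N)"
    using children_bounds(2)[OF assms(2)] by (intro mult_le_mono2)
  then show ?thesis
    using children_bounds(2)[OF assms(1)] assms(3) unfolding last_grandchild_def by linarith
qed

lemma child_less:
  assumes "c \<in> children N a s" "last_grandchild a < n"
  shows "c < n"
proof -
  have "2 * N * c + 1 \<in> children N c True" using N_pos by (simp add: children_def)
  from grandchild_less[OF this assms] children_bounds(1)[OF this] show ?thesis by simp
qed

lemma last_grandchild_ge: "x \<le> last_grandchild x"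
proof -
  have "x \<le> 2 * N * x" using N_pos by simp
  also have "\<dots> \<le> 2 * N * (2 * N * x)" using N_pos by simp
  also have "\<dots> \<le> last_grandchild x" by (simp add: last_grandchild_def distrib_left)
  finally show ?thesis .
qed

section \<open>Most children precede their parent\<close>

text \<open>Otherwise all these \<open>d\<close> come after \<open>c\<close> and hence after
  \<open>a\<close>. As \<open>p * p < N\<close>, two of them have equal queues towards
  \<open>c\<close> and equal queues towards \<open>a\<close>; the edges to \<open>c\<close> demand
  increasing order, those to \<open>a\<close> decreasing order.\<close>

lemma left_grandchild:
  assumes a: "last_grandchild a < n" and c: "c \<in> children N a s" "a \<sqsubset> c"
  shows "\<exists>d\<in>children N c False. d \<sqsubset> c"
proof (rule ccontr)
  assume none: "\<not> ?thesis"
  have d: "d < n" "c \<sqsubset> d" "a \<sqsubset> d" if "d \<in> children N c False" for d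
  proof -
    show "d < n" using grandchild_less[OF that c(1) a] .
    then show "c \<sqsubset> d"
      using before_total[of d c] none that child_less[OF c(1) a] children_bounds(1)[OF that] by auto
    then show "a \<sqsubset> d" by (rule before_trans[OF c(2)])
  qed
  let ?f = "\<lambda>d. (Q {c, d}, Q {a, d})"
  have "p * p < N" using power_increasing[of 2 3 p] N by (cases "p = 0") (auto simp: power2_eq_square)
  then have "\<exists>d\<in>children N c False. \<exists>d'\<in>children N c False. d < d' \<and> ?f d = ?f d'"
    using Q_less child_edge grandchild_edge c d
    by (intro pigeonhole_less[where B = "{..<p} \<times> {..<p}"]) (auto simp: card_cartesian_product)
  then obtain d d' where dd: "d \<in> children N c False" "d' \<in> children N c False" "d < d'"
    "Q {c, d} = Q {c, d'}" "Q {a, d} = Q {a, d'}" by auto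
  note E = child_edge[OF dd(1) d(1)[OF dd(1)]] child_edge[OF dd(2) d(1)[OF dd(2)]]
    grandchild_edge[OF dd(1) c(1) d(1)[OF dd(1)]] grandchild_edge[OF dd(2) c(1) d(1)[OF dd(2)]]
  show False
  proof (cases "d \<sqsubset> d'")
    case True
    then show False using no_conflict[of a d a d'] E dd d by simp
  next
    case False
    then have "d' \<sqsubset> d" using before_total dd d by simp
    then show False using no_conflict[of c d' c d] E dd d tree_weight_siblings[OF dd(1,2)] by simp
  qed
qed

text \<open>Two right children \<open>c < c'\<close> of \<open>a\<close> with equal queues are ordered \<open>c \<sqsubset> c'\<close>, and both have
  a left child, \<open>d\<close> and \<open>d'\<close>. Either \<open>d\<close> and \<open>d'\<close> precede \<open>a\<close>, or the edges to \<open>a\<close> force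
  \<open>d' \<sqsubset> d\<close>. In both cases \<open>{d, c}\<close> and \<open>{d', c'}\<close> conflict.\<close>

lemma few_right_children:
  assumes a: "last_grandchild a < n"
  shows "card {c \<in> children N a s. a \<sqsubset> c} \<le> 2 * p ^ 3"
proof (rule ccontr)
  let ?R = "{c \<in> children N a s. a \<sqsubset> c}"
  assume "\<not> ?thesis"
  then have big: "2 * p ^ 3 < card ?R" by simp
  have "\<forall>c\<in>?R. \<exists>d. d \<in> children N c False \<and> d \<sqsubset> c" using left_grandchild[OF a] by blast
  then obtain g where "\<forall>c\<in>?R. g c \<in> children N c False \<and> g c \<sqsubset> c" by (rule bchoice[THEN exE])
  then have g: "g c \<in> children N c False" "g c \<sqsubset> c" if "c \<in> ?R" for c using that by blast+
  have gn: "g c < n" "c < n" if "c \<in> ?R" for c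
  proof -
    have c: "c \<in> children N a s" using that by simp
    show "g c < n" "c < n" using grandchild_less[OF g(1)[OF that] c a] child_less[OF c a] .
  qed
  \<comment> \<open>The Boolean puts both chosen grandchildren on the same side of \<open>a\<close>;
    it causes the factor 2 in the bound.\<close>
  let ?f = "\<lambda>c. (Q {a, c}, Q {a, g c}, Q {g c, c}, a \<sqsubset> g c)"
  have "?f c \<in> {..<p} \<times> {..<p} \<times> {..<p} \<times> UNIV" if "c \<in> ?R" for c
  proof -
    have c: "c \<in> children N a s" using that by simp
    show ?thesis
      using Q_less[OF child_edge(2)[OF c gn(2)[OF that]]] Q_less[OF child_edge(1)[OF g(1)[OF that] gn(1)[OF that]]]
        Q_less[OF grandchild_edge(1)[OF g(1)[OF that] c gn(1)[OF that]]] by simp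
  qed
  then have "?f ` ?R \<subseteq> {..<p} \<times> {..<p} \<times> {..<p} \<times> UNIV" by blast
  then have "\<exists>c\<in>?R. \<exists>c'\<in>?R. c < c' \<and> ?f c = ?f c'"
    by (rule pigeonhole_less)
      (use big in \<open>simp_all add: card_cartesian_product power3_eq_cube mult_ac\<close>)
  then obtain c c' where c: "c \<in> ?R" "c' \<in> ?R" "c < c'" "Q {a, c} = Q {a, c'}"
    "Q {a, g c} = Q {a, g c'}" "Q {g c, c} = Q {g c', c'}" "a \<sqsubset> g c \<longleftrightarrow> a \<sqsubset> g c'" by blast
  have cs: "c \<in> children N a s" "c' \<in> children N a s" "a \<sqsubset> c" "a \<sqsubset> c'" using c by auto
  note gc = g[OF c(1)] g[OF c(2)] gn[OF c(1)] gn[OF c(2)]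
  note E = child_edge[OF cs(1) gc(6)] child_edge[OF cs(2) gc(8)] child_edge[OF gc(1) gc(5)] child_edge[OF gc(3) gc(7)]
    grandchild_edge[OF gc(1) cs(1) gc(5)] grandchild_edge[OF gc(3) cs(2) gc(7)]
  have cc: "c \<sqsubset> c'"
  proof (rule ccontr)
    assume "\<not> c \<sqsubset> c'"
    then have "c' \<sqsubset> c" using before_total[of c c'] gc c(3) by simp
    then show False
      using no_conflict[of a c' a c] E c(4) cs tree_weight_siblings[OF cs(1,2) c(3)] by simp
  qed
  \<comment> \<open>The middle digit is reversed for this kind, so the edge below the earlier
    sibling \<open>c\<close> is the heavier one.\<close>
  have w: "tree_weight N (g c') < tree_weight N (g c)"
    using tree_weight_cousins[OF cs(1,2) c(3) gc(1) gc(3)] by simp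
  have "g c' \<sqsubset> c"
  proof (cases "a \<sqsubset> g c")
    case True
    have "2 * N * (c + 1) \<le> 2 * N * c'" using c(3) by (intro mult_le_mono2) simp
    then have less: "g c < g c'"
      using children_bounds(2)[OF gc(1)] children_slot(4)[OF gc(3)] by simp
    have "\<not> g c \<sqsubset> g c'"
    proof
      assume "g c \<sqsubset> g c'"
      then show False using no_conflict[of a "g c" a "g c'"] E c(5,7) True less by simp
    qed
    then have "g c' \<sqsubset> g c" using before_total[of "g c" "g c'"] gc less by simp
    then show ?thesis by (rule before_trans[OF _ gc(2)])
  next
    case False
    have "a < n" using last_grandchild_ge[of a] a by simp
    moreover have "a < g c'" using children_bounds(1)[OF gc(3)] children_bounds(1)[OF cs(2)] by simp
    ultimately have "g c' \<sqsubset> a" using before_total[of a "g c'"] False c(7) gc by simp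
    then show ?thesis by (rule before_trans[OF _ cs(3)])
  qed
  then show False using no_conflict[of "g c" c "g c'" c'] E gc c(6) cc w by simp
qed

text \<open>At least \<open>p ^ 3 + 1\<close> children precede \<open>x\<close>, so one of the
  \<open>p\<close> queues receives more than \<open>p\<^sup>2\<close> of their edges. This suffices
  for a later pigeonhole over pairs of queues.\<close>

lemma left_children_same_queue:
  assumes "last_grandchild x < n"
  shows "\<exists>A q. A \<subseteq> children N x b \<and> p\<^sup>2 < card A \<and> q < p \<and> (\<forall>y\<in>A. y \<sqsubset> x \<and> Q {y, x} = q)"
proof -
  let ?L = "{y \<in> children N x b. y \<sqsubset> x}"
  let ?R = "{y \<in> children N x b. x \<sqsubset> y}"
  have "x < n" using last_grandchild_ge[of x] assms by simp
  then have "y \<sqsubset> x \<or> x \<sqsubset> y" if "y \<in> children N x b" for y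
    using before_total[of y x] child_less[OF that assms] children_bounds(1)[OF that] by auto
  then have "children N x b = ?L \<union> ?R" by blast
  then have "N \<le> card ?L + card ?R" using card_Un_le[of ?L ?R] by simp
  then have "p * p\<^sup>2 < card ?L"
    using few_right_children[OF assms, of b] N by (simp add: power2_eq_square power3_eq_cube)
  moreover have "Q {y, x} < p" if "y \<in> children N x b" for y
    using Q_less[OF child_edge(1)[OF that child_less[OF that assms]]] .
  ultimately obtain q where "q < p" "p\<^sup>2 < card {y \<in> ?L. Q {y, x} = q}"
    using pigeonhole_fibre[of ?L "\<lambda>y. Q {y, x}" p "p\<^sup>2"] by auto
  then show ?thesis by (intro exI[of _ "{y \<in> ?L. Q {y, x} = q}"] exI[of _ q]) simp
qed

text \<open>A queue in \<open>S\<close> contains an edge from a node before \<open>x\<close> and before all of \<open>X\<close> to an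
  ancestor of \<open>x\<close>. This edge is lighter than the edges from \<open>X\<close> to \<open>x\<close> but ends after \<open>x\<close>, so
  that these cannot use the same queue.\<close>

definition blocked :: "nat \<Rightarrow> nat set \<Rightarrow> nat set \<Rightarrow> bool" where
  "blocked x X S \<longleftrightarrow> (\<forall>s\<in>S. \<exists>m v b. m \<in> children N v b \<and> m < n \<and> Q {m, v} = s \<and>
     0 < v \<and> v \<le> parent (2 * N) x \<and> x \<sqsubset> v \<and> m \<sqsubset> x \<and> (\<forall>y\<in>X. m \<sqsubset> y))"

text \<open>The leading digit is the parent of \<open>v\<close> for \<open>{m, v}\<close> and the
  parent of \<open>x\<close> for \<open>{y, x}\<close>. The former is smaller because
  \<open>0 < v\<close> makes the parent of \<open>v\<close> smaller than \<open>v\<close>.\<close>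

lemma blocked_notin:
  assumes "blocked x X S" "y \<in> X" "y \<in> children N x b" "y < n" "y \<sqsubset> x"
  shows "Q {y, x} \<notin> S"
proof
  assume "Q {y, x} \<in> S"
  then obtain m v b' where m: "m \<in> children N v b'" "m < n" "Q {m, v} = Q {y, x}"
    "0 < v" "v \<le> parent (2 * N) x" "x \<sqsubset> v" "m \<sqsubset> x"
    using assms(1) by (auto simp: blocked_def)
  interpret rooted_tree "parent (2 * N)" by (rule rooted_tree_parent)
  have "parent (2 * N) v + 1 \<le> v" using f_less[OF m(4)] by simp
  also have "v \<le> parent (2 * N) x" by (fact m(5))
  finally have "(parent (2 * N) v + 1) * (2 * N)\<^sup>2 \<le> parent (2 * N) x * (2 * N)\<^sup>2"
    by (rule mult_le_mono1)
  then have "tree_weight N m < tree_weight N y"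
    using tree_weight_bounds(2)[OF N_pos, of m] tree_weight_bounds(1)[OF N_pos, of y]
      children_slot(1)[OF m(1)] children_slot(1)[OF assms(3)] by simp
  then show False
    using no_conflict[of y x m v] child_edge[OF assms(3,4)] child_edge[OF m(1,2)] m assms(5) by simp
qed

section \<open>The walk down the tree\<close>

text \<open>Two of the more than \<open>p\<^sup>2\<close> siblings in \<open>X\<close> agree in the
  queues below them for both kinds of children. If a selected child of the later one came before the
  earlier one \<open>m\<close>, its edge would conflict with an edge below \<open>m\<close>,
  provided the latter is heavier; the kind \<open>c\<close> is chosen to achieve this.\<close>

lemma next_level:
  assumes x: "last_grandchild x < n" and X: "X \<subseteq> children N x b" "p\<^sup>2 < card X"
    and deep: "\<And>y. y \<in> X \<Longrightarrow> last_grandchild y < n"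
  shows "\<exists>m\<in>X. \<exists>y\<in>X. \<exists>Y c q. m \<sqsubset> y \<and> Y \<subseteq> children N y c \<and> p\<^sup>2 < card Y \<and>
    (\<forall>z\<in>Y. z \<sqsubset> y \<and> Q {z, y} = q \<and> m \<sqsubset> z)"
proof -
  have "\<forall>y\<in>X. \<forall>c. \<exists>Aq. fst Aq \<subseteq> children N y c \<and> p\<^sup>2 < card (fst Aq) \<and> snd Aq < p \<and>
      (\<forall>z\<in>fst Aq. z \<sqsubset> y \<and> Q {z, y} = snd Aq)"
    using left_children_same_queue[OF deep] by (metis fst_conv snd_conv)
  then obtain h where h: "\<And>y c. y \<in> X \<Longrightarrow> fst (h y c) \<subseteq> children N y c \<and> p\<^sup>2 < card (fst (h y c)) \<and>
      snd (h y c) < p \<and> (\<forall>z\<in>fst (h y c). z \<sqsubset> y \<and> Q {z, y} = snd (h y c))"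
    by metis
  let ?A = "\<lambda>y c. fst (h y c)" and ?q = "\<lambda>y c. snd (h y c)"
  have "(\<lambda>y. (?q y True, ?q y False)) ` X \<subseteq> {..<p} \<times> {..<p}" using h by auto
  then have "\<exists>y\<in>X. \<exists>y'\<in>X. y < y' \<and> (?q y True, ?q y False) = (?q y' True, ?q y' False)"
    using X(2) by (intro pigeonhole_less) (auto simp: card_cartesian_product power2_eq_square)
  then obtain y y' where y: "y \<in> X" "y' \<in> X" "y < y'"
    "?q y True = ?q y' True" "?q y False = ?q y' False" by blast
  have n: "z < n" if "z \<in> X" for z using last_grandchild_ge[of z] deep[OF that] by simp
  have key: ?thesis if m: "m \<in> X" "v \<in> X" "m \<sqsubset> v" "?q m c = ?q v c"
    and w: "\<And>d d'. d \<in> children N m c \<Longrightarrow> d' \<in> children N v c \<Longrightarrow> tree_weight N d' < tree_weight N d"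
    for m v c
  proof -
    have "?A m c \<noteq> {}" using h[OF m(1), of c] by auto
    then obtain d where d: "d \<in> ?A m c" by blast
    have dm: "d \<in> children N m c" "d \<sqsubset> m" "Q {d, m} = ?q m c" using h[OF m(1), of c] d by auto
    have "m \<sqsubset> z" if z: "z \<in> ?A v c" for z
    proof (rule ccontr)
      assume not: "\<not> m \<sqsubset> z"
      have zv: "z \<in> children N v c" "z \<sqsubset> v" "Q {z, v} = ?q v c" using h[OF m(2), of c] z by auto
      have less: "d < n" "z < n"
        using child_less dm(1) zv(1) deep m(1,2) by blast+
      show False
      proof (cases "z = m")
        \<comment> \<open>The order compares distinct nodes only; \<open>z = m\<close> would make
          \<open>m\<close> a child of its own sibling \<open>v\<close>.\<close>
        case True
        have "m \<in> children N x b" "v \<in> children N x b" using m X by auto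
        then have "parent (2 * N) m = x" "parent (2 * N) m = v" "x < v"
          using children_slot(1) zv(1) True children_bounds(1) by blast+
        then show False by simp
      next
        case False
        then have "z \<sqsubset> m" using before_total[of m z] not less n m(1) by simp
        then show False
          using no_conflict[of d m z v] child_edge[OF dm(1) less(1)] child_edge[OF zv(1) less(2)]
            dm zv m(3,4) w by simp
      qed
    qed
    then show ?thesis using h[OF m(2), of c] m(1-3) by blast
  qed
  have yx: "y \<in> children N x b" "y' \<in> children N x b" using y X by auto
  \<comment> \<open>The layout may or may not follow the numbering of the two siblings; in each case
    one kind makes the edges below the earlier sibling heavier.\<close>
  show ?thesis
  proof (cases "y \<sqsubset> y'")
    case True
    then show ?thesis
      using key[OF y(1,2) True y(5)] tree_weight_cousins[OF yx y(3), where b = False] by simp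
  next
    case False
    then have "y' \<sqsubset> y" using before_total[of y y'] n y by simp
    then show ?thesis
      using key[OF y(2,1) _ y(4)[symmetric]] tree_weight_cousins[OF yx y(3), where b = True]
      by simp
  qed
qed

text \<open>Induction on the level \<open>t\<close>; each step adds the queue of the edges from
  \<open>X\<close> to \<open>x\<close> to \<open>S\<close>. The iterated function maps a node to its
  last child, so its iterates from \<open>1\<close> bound the nodes reached.\<close>

lemma blocked_exists:
  assumes "last_grandchild (((\<lambda>x. 2 * N * x + 2 * N) ^^ (t + 1)) 1) < n"
  shows "\<exists>x X S b q. 0 < x \<and> x \<le> ((\<lambda>x. 2 * N * x + 2 * N) ^^ t) 1 \<and> X \<subseteq> children N x b \<and>
    p\<^sup>2 < card X \<and> (\<forall>y\<in>X. y \<sqsubset> x \<and> Q {y, x} = q) \<and> blocked x X S \<and> S \<subseteq> {..<p} \<and> card S = t"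
  using assms
proof (induction t)
  case 0
  have "last_grandchild 1 \<le> last_grandchild (2 * N * 1 + 2 * N)"
    by (simp add: last_grandchild_def)
  then have "last_grandchild 1 < n" using 0 by simp
  \<comment> \<open>The walk starts at node \<open>1\<close> instead of the root because its nodes
    become the \<open>v\<close> of \<open>blocked\<close>, which must be positive.\<close>
  then obtain A q where "A \<subseteq> children N 1 True" "p\<^sup>2 < card A" "\<forall>y\<in>A. y \<sqsubset> 1 \<and> Q {y, 1} = q"
    using left_children_same_queue by meson
  moreover have "blocked 1 A {}" by (simp add: blocked_def)
  ultimately show ?case
    by (intro exI[of _ "1 :: nat"] exI[of _ A] exI[of _ "{}"] exI[of _ True] exI[of _ q]) simp
next
  case (Suc t)
  let ?k = "\<lambda>x. 2 * N * x + 2 * N"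
  have mono: "last_grandchild y < n" if "y \<le> z" "last_grandchild z < n" for y z
  proof -
    have "last_grandchild y \<le> last_grandchild z" using that(1) by (simp add: last_grandchild_def)
    then show ?thesis using that(2) by simp
  qed
  have le: "z \<le> ?k z" for z using N_pos by (cases N) auto
  have d2: "last_grandchild ((?k ^^ (t + 1)) 1) < n" and d1: "last_grandchild ((?k ^^ t) 1) < n"
    using mono[OF le, of "(?k ^^ (t + 1)) 1"] mono[OF le, of "(?k ^^ t) 1"] Suc.prems by simp_all
  obtain x X S b q where x: "0 < x" "x \<le> (?k ^^ t) 1" "X \<subseteq> children N x b" "p\<^sup>2 < card X"
    "\<And>y. y \<in> X \<Longrightarrow> y \<sqsubset> x \<and> Q {y, x} = q" "blocked x X S" "S \<subseteq> {..<p}" "card S = t"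
    using Suc.IH[OF d2] by blast
  have xn: "last_grandchild x < n" using mono[OF x(2) d1] .
  have X_le: "y \<le> (?k ^^ Suc t) 1" if "y \<in> X" for y
  proof -
    have "y \<le> ?k x" using that x(3) children_bounds(2) by blast
    also have "\<dots> \<le> ?k ((?k ^^ t) 1)" using x(2) by simp
    finally show ?thesis by simp
  qed
  have Xn: "last_grandchild y < n" if "y \<in> X" for y
    using mono[OF X_le[OF that]] d2 by simp
  obtain m y Y c q' where my: "m \<in> X" "y \<in> X" "m \<sqsubset> y" "Y \<subseteq> children N y c" "p\<^sup>2 < card Y"
    "\<And>z. z \<in> Y \<Longrightarrow> z \<sqsubset> y \<and> Q {z, y} = q' \<and> m \<sqsubset> z"
    using next_level[OF xn x(3,4) Xn] by blast
  have mx: "m \<in> children N x b" "y \<in> children N x b" using my x(3) by auto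
  have mn: "m < n" using child_less[OF mx(1) xn] .
  have py: "parent (2 * N) y = x" using children_slot(1)[OF mx(2)] .
  have q: "q \<notin> S" "q < p"
    using blocked_notin[OF x(6) my(1) mx(1) mn] x(5)[OF my(1)] Q_less[OF child_edge(1)[OF mx(1) mn]] by auto
  have "blocked y Y (insert q S)"
    unfolding blocked_def
  proof
    fix s assume "s \<in> insert q S"
    then consider "s = q" | "s \<in> S" by blast
    then show "\<exists>m v b. m \<in> children N v b \<and> m < n \<and> Q {m, v} = s \<and>
     0 < v \<and> v \<le> parent (2 * N) y \<and> y \<sqsubset> v \<and> m \<sqsubset> y \<and> (\<forall>y\<in>Y. m \<sqsubset> y)"
    proof cases
      \<comment> \<open>The new queue is blocked by the edge \<open>{m, x}\<close>, where
        \<open>m\<close> precedes \<open>y\<close> and all of \<open>Y\<close>, and \<open>y\<close>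
        precedes \<open>x\<close>.\<close>
      case 1
      then show ?thesis using mx mn x(1) x(5)[OF my(1)] x(5)[OF my(2)] py my by blast
    next
      \<comment> \<open>An old edge \<open>{m', v}\<close> still blocks: \<open>m'\<close> precedes
        \<open>y\<close> and \<open>m\<close>, hence also \<open>Y\<close>, and \<open>y\<close>
        precedes \<open>x\<close> and thus \<open>v\<close>.\<close>
      case 2
      then obtain m' v b' where v: "m' \<in> children N v b'" "m' < n" "Q {m', v} = s"
        "0 < v" "v \<le> parent (2 * N) x" "x \<sqsubset> v" "m' \<sqsubset> x" "\<And>z. z \<in> X \<Longrightarrow> m' \<sqsubset> z"
        using x(6) unfolding blocked_def by blast
      have "v \<le> parent (2 * N) y"
        using v(5) py rooted_tree.f_le[OF rooted_tree_parent, of "2 * N" x] by simp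
      moreover have "y \<sqsubset> v" using before_trans x(5)[OF my(2)] v(6) by blast
      moreover have "m' \<sqsubset> y" "\<forall>z\<in>Y. m' \<sqsubset> z" using v(8) my before_trans by blast+
      ultimately show ?thesis using v by blast
    qed
  qed
  moreover have "insert q S \<subseteq> {..<p}" "card (insert q S) = Suc t"
    using x(7,8) q finite_subset[OF x(7)] by auto
  moreover have "0 < y" using children_bounds(1)[OF mx(2)] by simp
  moreover have "\<forall>z\<in>Y. z \<sqsubset> y \<and> Q {z, y} = q'" using my(6) by blast
  ultimately show ?case using X_le[OF my(2)] my(4,5) by meson
qed

end

theorem theorem5p2:
  fixes p :: nat
  assumes "p > 0"
  shows "\<exists>(V :: nat set) E. simple_graph V E \<and> treewidth V E = 2 \<and> pqn V E \<ge> p"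
proof -
  define N where "N = 3 * p ^ 3 + 1"
  \<comment> \<open>The exponent \<open>p + 2\<close> admits \<open>Suc p\<close> levels of the
    walk; \<open>n\<close> then exceeds the last grandchild of \<open>big\<close> by one.\<close>
  define big where "big = ((\<lambda>x. 2 * N * x + 2 * N) ^^ (p + 2)) 1"
  define n where "n = 2 * N * (2 * N * big + 2 * N) + 2 * N + 1"
  let ?E = "grandparent_graph N n"
  interpret rooted_tree "parent (2 * N)" n by (rule rooted_tree_parent)
  have graph: "simple_graph {..<n} ?E"
    using simple_graph_grandparent by (simp add: grandparent_graph_def)
  have "2 * N * 1 \<le> 2 * N * (2 * N * big + 2 * N)"
    using N_def by (intro mult_le_mono2) simp
  \<comment> \<open>Node \<open>2 * N + 1\<close> is the first child of node \<open>1\<close>, so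
    these two and the root form a triangle.\<close>
  then have "2 * N + 1 < n" using N_def by (simp add: n_def)
  moreover have "parent (2 * N) (2 * N + 1) = 1" using N_def by (simp add: parent_def)
  ultimately have tw: "treewidth {..<n} ?E = 2"
    using treewidth_grandparent[of "2 * N + 1"] by (simp add: grandparent_graph_def)
  have "p \<le> pqn {..<n} ?E"
  proof (rule ccontr)
    assume "\<not> ?thesis"
    then have less: "pqn_weighted {..<n} ?E (edge_weight N) < p"
      using pqn_weighted_le_pqn[OF graph, of "edge_weight N"] by simp
    obtain k r P where k: "k < p" and lay: "PQ_layout {..<n} ?E (edge_weight N) k r P"
      using pqn_weighted_attained[OF graph] less by blast
    define Q where "Q e = (SOME i. i < k \<and> e \<in> P i)" for e
    have Q: "Q e < k \<and> e \<in> P (Q e)" if "e \<in> ?E" for e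
    proof -
      have "(\<Union>i<k. P i) = ?E" using lay by (simp add: PQ_layout_def)
      then have "\<exists>i. i < k \<and> e \<in> P i" using that by blast
      then show ?thesis unfolding Q_def by (rule someI_ex)
    qed
    interpret few_queues p N n r Q
    proof
      show "N = 3 * p ^ 3 + 1" by (fact N_def)
      show "strict_linear_order_on {..<n} r" using lay by (simp add: PQ_layout_def)
      show "Q e < p" if "e \<in> ?E" for e using Q[OF that] k by simp
      have no: "\<not> (\<exists>i<k. \<exists>u v u' v'. {u, v} \<in> P i \<and> {u', v'} \<in> P i \<and>
          edge_weight N {u, v} > edge_weight N {u', v'} \<and> (u, v) \<in> r \<and> (u', v) \<in> r \<and> (v, v') \<in> r)"
        using lay unfolding PQ_layout_def by (elim conjE)
      fix u v u' v'
      assume e: "{u, v} \<in> ?E" "{u', v'} \<in> ?E" "Q {u, v} = Q {u', v'}"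
        "edge_weight N {u', v'} < edge_weight N {u, v}" "(u, v) \<in> r" "(u', v) \<in> r" "(v, v') \<in> r"
      have "{u', v'} \<in> P (Q {u, v})" using Q[OF e(2)] e(3) by simp
      then show False using no Q[OF e(1)] e(4-7) by blast
    qed
    \<comment> \<open>At level \<open>Suc p\<close> there would be \<open>p + 1\<close> distinct
      queues with numbers below \<open>p\<close>.\<close>
    have "last_grandchild (((\<lambda>x. 2 * N * x + 2 * N) ^^ (Suc p + 1)) 1) < n"
      by (simp add: last_grandchild_def n_def big_def)
    from blocked_exists[OF this] obtain S where "S \<subseteq> {..<p}" "card S = Suc p" by blast
    then show False using card_mono[of "{..<p}" S] by simp
  qed
  with graph tw show ?thesis by blast
qed

end
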